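(* Let $\tau>0$ be fixed and let $C_n$ be the cycle graph on $n$ vertices. Then, as $n\to\infty$, $$S(\varrho^\tau_{A(C_n)})=S(\varrho^\tau_{L(C_n)})=\log n-2\tau\,\frac{I_1(2\tau)}{I_0(2\tau)}+\log\big(I_0(2\tau)\big)+o(1),$$ where $I_\alpha$ is the modified Bessel function of the first kind of order $\alpha$.
   Context: For a simple undirected graph $G$, $A(G)$ is the adjacency matrix, $D(G)$ the diagonal degree matrix, and $L(G)=D(G)-A(G)$ the Laplacian. For a Hermitian matrix $H$ and real $\tau$, the Gibbs state is $\varrho_H^\tau=\exp(-\tau H)/\mathrm{Tr}(\exp(-\tau H))$, and $S(\varrho)=-\mathrm{Tr}(\varrho\log\varrho)$ is the von Neumann entropy (natural logarithm). Convention for adjacency matrices: $S(\varrho_{A(G)}^\tau)$ denotes the entropy of the Gibbs state with $H=-A(G)$, i.e. of $\exp(\tau A(G))/\mathrm{Tr}(\exp(\tau A(G)))$; for $L(G)$ one takes $H=L(G)$. $o(1)$ denotes a quantity converging to $0$. *)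

theory Defs
  imports
    "HOL-Analysis.Gamma_Function"
    "HOL-Library.Landau_Symbols"
    "Jordan_Normal_Form.Schur_Decomposition"
begin

text \<open>Since the order of the graph varies, matrices are the size-indexed ones of
  \<open>Jordan_Normal_Form\<close>. A simple undirected graph of order \<open>n\<close> has vertex set
  \<open>{..<n}\<close> and a set of two-element edges.\<close>

definition simple_graph :: "nat \<Rightarrow> nat set set \<Rightarrow> bool" where
  "simple_graph n E \<longleftrightarrow> (\<forall>e\<in>E. e \<subseteq> {..<n} \<and> card e = 2)"

definition adjacency_mat :: "nat \<Rightarrow> nat set set \<Rightarrow> complex mat" where
  "adjacency_mat n E = Matrix.mat n n (\<lambda>(i, j). if {i, j} \<in> E then 1 else 0)"

definition degree_mat :: "nat \<Rightarrow> nat set set \<Rightarrow> complex mat" where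
  "degree_mat n E = mat_diag n (\<lambda>i. of_nat (card {e \<in> E. i \<in> e}))"

definition laplacian_mat :: "nat \<Rightarrow> nat set set \<Rightarrow> complex mat" where
  "laplacian_mat n E = degree_mat n E - adjacency_mat n E"

definition cycle_edges :: "nat \<Rightarrow> nat set set" where
  "cycle_edges n = {{i, Suc i mod n} | i. i < n}"

lemma simple_graph_cycle_edges:
  assumes "n \<ge> 3"
  shows "simple_graph n (cycle_edges n)"
proof -
  have "Suc i mod n \<noteq> i" "Suc i mod n < n" if "i < n" for i
    using assms that by (cases "Suc i = n"; simp)+
  then show ?thesis
    unfolding simple_graph_def cycle_edges_def by (force simp: card_2_iff)
qed

definition mat_trace :: "'a :: comm_monoid_add mat \<Rightarrow> 'a" where
  "mat_trace A = (\<Sum>i<dim_row A. A $$ (i, i))"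

text \<open>The matrix exponential is the power series, summed entrywise.\<close>

definition mat_exp :: "complex mat \<Rightarrow> complex mat" where
  "mat_exp A = Matrix.mat (dim_row A) (dim_row A)
     (\<lambda>(i, j). \<Sum>k. (A ^\<^sub>m k) $$ (i, j) / fact k)"

definition unitary_mat :: "complex mat \<Rightarrow> bool" where
  "unitary_mat U \<longleftrightarrow> square_mat U \<and> U * mat_adjoint U = 1\<^sub>m (dim_row U)
     \<and> mat_adjoint U * U = 1\<^sub>m (dim_row U)"

text \<open>The real functional calculus of a Hermitian matrix,
  \<open>f (U diag(d) U\<^sup>*) = U diag(f \<circ> d) U\<^sup>*\<close>; the result does not depend on the
  chosen spectral decomposition.\<close>

definition hermitian_fun :: "(real \<Rightarrow> real) \<Rightarrow> complex mat \<Rightarrow> complex mat" where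
  "hermitian_fun f A = (THE B. \<exists>U d. U \<in> carrier_mat (dim_row A) (dim_row A) \<and> unitary_mat U
     \<and> A = U * mat_diag (dim_row A) (\<lambda>i. of_real (d i)) * mat_adjoint U
     \<and> B = U * mat_diag (dim_row A) (\<lambda>i. of_real (f (d i))) * mat_adjoint U)"

text \<open>Since \<open>ln 0 = 0\<close> in HOL, the convention \<open>0 log 0 = 0\<close> holds in the entropy of a
  singular state. The real part only serves to make the (real) trace an element of \<open>real\<close>.\<close>

definition mat_log :: "complex mat \<Rightarrow> complex mat" where
  "mat_log = hermitian_fun ln"

definition von_neumann_entropy :: "complex mat \<Rightarrow> real" where
  "von_neumann_entropy \<rho> = - Re (mat_trace (\<rho> * mat_log \<rho>))"

definition gibbs_state :: "complex mat \<Rightarrow> real \<Rightarrow> complex mat" where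
  "gibbs_state H \<tau> = (let E = mat_exp (of_real (- \<tau>) \<cdot>\<^sub>m H) in (1 / mat_trace E) \<cdot>\<^sub>m E)"

text \<open>For adjacency matrices the Hamiltonian is \<open>- A\<close>.\<close>

definition adjacency_entropy :: "nat \<Rightarrow> nat set set \<Rightarrow> real \<Rightarrow> real" where
  "adjacency_entropy n E \<tau> = von_neumann_entropy (gibbs_state (- adjacency_mat n E) \<tau>)"

definition laplacian_entropy :: "nat \<Rightarrow> nat set set \<Rightarrow> real \<Rightarrow> real" where
  "laplacian_entropy n E \<tau> = von_neumann_entropy (gibbs_state (laplacian_mat n E) \<tau>)"

text \<open>Modified Bessel function of the first kind of real order, for \<open>x > 0\<close> (the real power
  is not meaningful at other arguments); \<open>rGamma = 1 / Gamma\<close>, extended by \<open>0\<close> at the poles.\<close>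

definition bessel_I :: "real \<Rightarrow> real \<Rightarrow> real" where
  "bessel_I \<alpha> x =
     (\<Sum>m. rGamma (real m + \<alpha> + 1) / fact m * (x / 2) powr (2 * real m + \<alpha>))"

end

theory Submission
  imports Defs
begin

text \<open>The Fourier matrix diagonalises the adjacency matrix of \<open>C\<^sub>n\<close>, with eigenvalues
  \<open>2 cos (2 \<pi> k / n)\<close>, and since \<open>C\<^sub>n\<close> is 2-regular its Laplacian is \<open>2 - A\<close>. The Hamiltonians
  \<open>- A\<close> and \<open>L\<close> thus differ by a multiple of the identity, which cancels in the normalised
  Gibbs state; so the two entropies agree. In an eigenbasis the entropy of the Gibbs state is
  \<open>\<tau>\<close> times the mean energy plus the logarithm of the partition function
  (\<open>entropy_gibbs_state\<close>), so it is determined by the means over the spectrum of \<open>exp (\<tau> x)\<close> and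
  \<open>x exp (\<tau> x)\<close>; the term \<open>log n\<close> comes from passing from sums to means.

  Both means are computed termwise from the power series. The mean of \<open>x\<^sup>m\<close> over the spectrum
  counts closed walks of length \<open>m\<close> from a vertex of \<open>C\<^sub>n\<close>. For \<open>n > m\<close> such a walk cannot go
  round the cycle, so the count is that of closed walks on the line: the central binomial
  coefficient for even \<open>m\<close> and \<open>0\<close> for odd \<open>m\<close> (\<open>cycle_mean_power\<close>). As all eigenvalues are at
  most \<open>2\<close> in absolute value, Tannery's theorem allows the limit to be taken under the sum
  (\<open>cycle_mean_powser_tendsto\<close>), and the limiting series are those of \<open>I\<^sub>0 (2 \<tau>)\<close> and
  \<open>2 I\<^sub>1 (2 \<tau>)\<close>.\<close>

section \<open>Functions of a unitarily diagonalised matrix\<close>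

definition spectral_mat :: "complex mat \<Rightarrow> (nat \<Rightarrow> complex) \<Rightarrow> complex mat" where
  "spectral_mat U d = U * mat_diag (dim_row U) d * mat_adjoint U"

lemma mat_adjoint_dim [simp]:
  "dim_row (mat_adjoint U) = dim_col U" "dim_col (mat_adjoint U) = dim_row U"
  unfolding mat_adjoint_def by auto

lemma spectral_mat_dim [simp]:
  "dim_row (spectral_mat U d) = dim_row U" "dim_col (spectral_mat U d) = dim_row U"
  unfolding spectral_mat_def by auto

lemma mat_adjoint_carrier: "U \<in> carrier_mat n n \<Longrightarrow> mat_adjoint U \<in> carrier_mat n n"
  by auto

lemma mat_adjoint_index:
  assumes "U \<in> carrier_mat n n" "i < n" "j < n"
  shows "mat_adjoint U $$ (i, j) = cnj (U $$ (j, i))"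
  using assms unfolding mat_adjoint_def by (auto simp: mat_of_rows_index)

lemma spectral_mat_carrier: "U \<in> carrier_mat n n \<Longrightarrow> spectral_mat U d \<in> carrier_mat n n"
  by auto

lemma spectral_mat_index:
  assumes U: "U \<in> carrier_mat n n" and "i < n" "j < n"
  shows "spectral_mat U d $$ (i, j) = (\<Sum>k<n. U $$ (i, k) * d k * cnj (U $$ (j, k)))"
proof -
  have "spectral_mat U d = Matrix.mat n n (\<lambda>(i, j). U $$ (i, j) * d j) * mat_adjoint U"
    using U unfolding spectral_mat_def by (simp add: mat_diag_mult_right)
  then show ?thesis
    using assms by (simp add: scalar_prod_def mat_adjoint_index[OF U] atLeast0LessThan)
qed

context
  fixes U :: "complex mat" and n :: nat
  assumes U: "U \<in> carrier_mat n n" and unitary: "unitary_mat U"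
begin

lemmas assoc = assoc_mult_mat[of _ n n _ n _ n] and mult_closed = mult_carrier_mat[of _ n n _ n]

lemma unitary_cancel: "U * mat_adjoint U = 1\<^sub>m n" "mat_adjoint U * U = 1\<^sub>m n"
  using unitary U unfolding unitary_mat_def by auto

lemma spectral_mat_mult:
  "spectral_mat U d * spectral_mat U e = spectral_mat U (\<lambda>k. d k * e k)"
proof -
  note carr = mat_diag_dim[of n d] mat_diag_dim[of n e] mat_adjoint_carrier[OF U] U
  have "spectral_mat U d * spectral_mat U e
      = U * mat_diag n d * (mat_adjoint U * (U * mat_diag n e * mat_adjoint U))"
    using U carr unfolding spectral_mat_def
    by (simp add: assoc mult_closed)
  also have "mat_adjoint U * (U * mat_diag n e * mat_adjoint U)
      = (mat_adjoint U * U) * (mat_diag n e * mat_adjoint U)"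
    using carr by (simp add: assoc mult_closed)
  also have "\<dots> = mat_diag n e * mat_adjoint U"
    using carr by (simp add: unitary_cancel left_mult_one_mat[of _ n n] mult_closed)
  also have "U * mat_diag n d * (mat_diag n e * mat_adjoint U)
      = U * (mat_diag n d * mat_diag n e) * mat_adjoint U"
    using carr by (simp add: assoc mult_closed del: mat_diag_diag)
  finally show ?thesis
    using U unfolding spectral_mat_def by simp
qed

lemma spectral_mat_one: "spectral_mat U (\<lambda>_. 1) = 1\<^sub>m n"
  using U unfolding spectral_mat_def by (simp add: unitary_cancel)

lemma spectral_mat_pow: "spectral_mat U d ^\<^sub>m k = spectral_mat U (\<lambda>i. d i ^ k)"
proof (induction k)
  case 0
  then show ?case using U by (simp add: spectral_mat_one)
next
  case (Suc k)
  then show ?case by (simp add: spectral_mat_mult mult.commute)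
qed

lemma spectral_mat_smult: "c \<cdot>\<^sub>m spectral_mat U d = spectral_mat U (\<lambda>k. c * d k)"
  using U by (intro eq_matI) (simp_all add: spectral_mat_index[OF U] sum_distrib_left algebra_simps)

lemma mat_trace_spectral_mat: "mat_trace (spectral_mat U d) = (\<Sum>k<n. d k)"
proof -
  \<comment> \<open>The trace does not see the basis because the columns of a unitary matrix have norm 1.\<close>
  have col: "(\<Sum>i<n. cnj (U $$ (i, k)) * U $$ (i, k)) = 1" if "k < n" for k
  proof -
    have "(mat_adjoint U * U) $$ (k, k) = 1"
      using that by (simp add: unitary_cancel)
    moreover have "(mat_adjoint U * U) $$ (k, k) = (\<Sum>i<n. cnj (U $$ (i, k)) * U $$ (i, k))"
      using that U
      by (simp add: scalar_prod_def mat_adjoint_index[OF U] atLeast0LessThan)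
    ultimately show ?thesis by simp
  qed
  have "mat_trace (spectral_mat U d) = (\<Sum>i<n. \<Sum>k<n. U $$ (i, k) * d k * cnj (U $$ (i, k)))"
    using U unfolding mat_trace_def by (simp add: spectral_mat_index[OF U])
  also have "\<dots> = (\<Sum>k<n. d k * (\<Sum>i<n. cnj (U $$ (i, k)) * U $$ (i, k)))"
    by (subst sum.swap) (simp add: sum_distrib_left algebra_simps)
  also have "\<dots> = (\<Sum>k<n. d k)"
    by (simp add: col)
  finally show ?thesis .
qed

lemma mat_exp_spectral_mat: "mat_exp (spectral_mat U d) = spectral_mat U (\<lambda>k. exp (d k))"
proof (rule eq_matI)
  have dim: "dim_row U = n" using U by auto
  show "dim_row (mat_exp (spectral_mat U d)) = dim_row (spectral_mat U (\<lambda>k. exp (d k)))"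
    "dim_col (mat_exp (spectral_mat U d)) = dim_col (spectral_mat U (\<lambda>k. exp (d k)))"
    by (simp_all add: mat_exp_def dim)
  fix i j assume "i < dim_row (spectral_mat U (\<lambda>k. exp (d k)))" "j < dim_col (spectral_mat U (\<lambda>k. exp (d k)))"
  then have ij: "i < n" "j < n" by (simp_all add: dim)
  have "(\<lambda>m. \<Sum>k<n. U $$ (i, k) * cnj (U $$ (j, k)) * (d k ^ m /\<^sub>R fact m))
      sums (\<Sum>k<n. U $$ (i, k) * cnj (U $$ (j, k)) * exp (d k))"
    by (intro sums_sum sums_mult exp_converges)
  moreover have "(\<lambda>m. \<Sum>k<n. U $$ (i, k) * cnj (U $$ (j, k)) * (d k ^ m /\<^sub>R fact m))
      = (\<lambda>m. (spectral_mat U d ^\<^sub>m m) $$ (i, j) / fact m)"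
    by (simp add: spectral_mat_pow spectral_mat_index[OF U ij] sum_divide_distrib
          scaleR_conv_of_real field_simps)
  ultimately show "mat_exp (spectral_mat U d) $$ (i, j) = spectral_mat U (\<lambda>k. exp (d k)) $$ (i, j)"
    using ij by (simp add: mat_exp_def dim spectral_mat_index[OF U ij] sums_iff algebra_simps)
qed

text \<open>The change of basis \<open>W = V\<^sup>* U\<close> between two eigenbases satisfies \<open>W diag(d) = diag(e) W\<close>,
  that is, \<open>W\<close> vanishes at \<open>(i, j)\<close> unless \<open>d j = e i\<close>. Then it also intertwines \<open>diag(f \<circ> d)\<close>
  and \<open>diag(f \<circ> e)\<close>. This makes the definite description in \<open>hermitian_fun\<close> meaningful.\<close>

lemma spectral_mat_fun_unique:
  assumes V: "V \<in> carrier_mat n n" and unitaryV: "unitary_mat V"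
    and eq: "spectral_mat U (\<lambda>k. of_real (d k)) = spectral_mat V (\<lambda>k. of_real (e k))"
  shows "spectral_mat U (\<lambda>k. of_real (f (d k) :: real)) = spectral_mat V (\<lambda>k. of_real (f (e k)))"
proof -
  define W where "W = mat_adjoint V * U"
  have W: "W \<in> carrier_mat n n"
    using U mat_adjoint_carrier[OF V] unfolding W_def by auto
  have VV: "V * mat_adjoint V = 1\<^sub>m n" "mat_adjoint V * V = 1\<^sub>m n"
    using unitaryV V unfolding unitary_mat_def by auto
  note carr = W V U mat_adjoint_carrier[OF U] mat_adjoint_carrier[OF V]
  have right: "spectral_mat U c * U = U * mat_diag n c" for c
  proof -
    have "spectral_mat U c * U = U * mat_diag n c * (mat_adjoint U * U)"
      using carr mat_diag_dim[of n c] unfolding spectral_mat_def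
      by (simp add: assoc mult_closed)
    then show ?thesis using carr by (simp add: unitary_cancel right_mult_one_mat[of _ n n])
  qed
  have left: "mat_adjoint V * spectral_mat V c = mat_diag n c * mat_adjoint V" for c
  proof -
    have "mat_adjoint V * spectral_mat V c = (mat_adjoint V * V) * (mat_diag n c * mat_adjoint V)"
      using carr mat_diag_dim[of n c] unfolding spectral_mat_def
      by (simp add: assoc mult_closed)
    then show ?thesis using carr by (simp add: VV left_mult_one_mat[of _ n n] mult_closed)
  qed
  have Ud: "mat_adjoint V * (spectral_mat U c * U) = W * mat_diag n c" for c
    using carr mat_diag_dim[of n c] unfolding right W_def
    by (simp add: assoc mult_closed)
  have Ve: "mat_adjoint V * (spectral_mat V c * U) = mat_diag n c * W" for c
    using carr mat_diag_dim[of n c] left[of c] spectral_mat_carrier[OF V, of c] unfolding W_def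
    by (simp add: assoc[symmetric] mult_closed)
  have "W * mat_diag n (\<lambda>k. of_real (d k)) = mat_diag n (\<lambda>k. of_real (e k)) * W"
    using Ud[of "\<lambda>k. of_real (d k)"] Ve[of "\<lambda>k. of_real (e k)"] eq by simp
  then have "Matrix.mat n n (\<lambda>(i, j). W $$ (i, j) * of_real (d j)) $$ (i, j)
      = Matrix.mat n n (\<lambda>(i, j). of_real (e i) * W $$ (i, j)) $$ (i, j)" for i j
    using W by (simp add: mat_diag_mult_left mat_diag_mult_right)
  then have "W $$ (i, j) * of_real (d j) = of_real (e i) * W $$ (i, j)" if "i < n" "j < n" for i j
    using that by (metis (no_types, lifting) index_mat(1) case_prod_conv)
  then have entry: "W $$ (i, j) = 0 \<or> d j = e i" if "i < n" "j < n" for i j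
    using that by (force simp: mult.commute[of "W $$ (i, j)"])
  have "W * mat_diag n (\<lambda>k. of_real (f (d k))) = mat_diag n (\<lambda>k. of_real (f (e k))) * W"
    unfolding mat_diag_mult_left[OF W] mat_diag_mult_right[OF W]
    by (intro eq_matI) (use entry in \<open>force+\<close>)
  then have "mat_adjoint V * (spectral_mat U (\<lambda>k. of_real (f (d k))) * U)
      = mat_adjoint V * (spectral_mat V (\<lambda>k. of_real (f (e k))) * U)"
    unfolding Ud Ve .
  moreover have "V * (mat_adjoint V * (B * U)) * mat_adjoint U = B"
    if B: "B \<in> carrier_mat n n" for B
  proof -
    have "V * (mat_adjoint V * (B * U)) * mat_adjoint U
        = (V * mat_adjoint V) * (B * (U * mat_adjoint U))"
      using carr B by (simp add: assoc mult_closed)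
    then show ?thesis using B carr by (simp add: VV unitary_cancel)
  qed
  ultimately show ?thesis
    using spectral_mat_carrier[OF U] spectral_mat_carrier[OF V] by metis
qed

lemma hermitian_fun_spectral_mat:
  "hermitian_fun f (spectral_mat U (\<lambda>k. of_real (d k))) = spectral_mat U (\<lambda>k. of_real (f (d k)))"
proof -
  have dim: "dim_row U = n" using U by auto
  show ?thesis
    unfolding hermitian_fun_def spectral_mat_dim dim
  proof (rule the_equality)
    show "\<exists>V e. V \<in> carrier_mat n n \<and> unitary_mat V
       \<and> spectral_mat U (\<lambda>k. of_real (d k)) = V * mat_diag n (\<lambda>i. of_real (e i)) * mat_adjoint V
       \<and> spectral_mat U (\<lambda>k. of_real (f (d k))) = V * mat_diag n (\<lambda>i. of_real (f (e i))) * mat_adjoint V"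
      using U unitary dim unfolding spectral_mat_def by auto
  next
    fix B
    assume "\<exists>V e. V \<in> carrier_mat n n \<and> unitary_mat V
       \<and> spectral_mat U (\<lambda>k. of_real (d k)) = V * mat_diag n (\<lambda>i. of_real (e i)) * mat_adjoint V
       \<and> B = V * mat_diag n (\<lambda>i. of_real (f (e i))) * mat_adjoint V"
    then obtain V e where V: "V \<in> carrier_mat n n" "unitary_mat V"
      and eq: "spectral_mat U (\<lambda>k. of_real (d k)) = spectral_mat V (\<lambda>i. of_real (e i))"
      and B: "B = spectral_mat V (\<lambda>i. of_real (f (e i)))"
      unfolding spectral_mat_def by auto
    show "B = spectral_mat U (\<lambda>k. of_real (f (d k)))"
      using spectral_mat_fun_unique[OF V eq, of f] B by simp
  qed
qed

text \<open>The Gibbs weights are \<open>p k = exp (- \<tau> h k) / Z\<close>, so \<open>- ln (p k) = \<tau> h k + ln Z\<close>, of which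
  the entropy is the \<open>p\<close>-mean.\<close>

lemma entropy_gibbs_state:
  fixes h :: "nat \<Rightarrow> real" and \<tau> :: real
  assumes "n > 0"
  defines "Z \<equiv> (\<Sum>k<n. exp (- \<tau> * h k))"
  shows "von_neumann_entropy (gibbs_state (spectral_mat U (\<lambda>k. of_real (h k))) \<tau>)
    = \<tau> * (\<Sum>k<n. h k * exp (- \<tau> * h k)) / Z + ln Z"
proof -
  have Z: "Z > 0"
    unfolding Z_def using \<open>n > 0\<close> by (intro sum_pos) auto
  define p where "p k = exp (- \<tau> * h k) / Z" for k
  have "mat_exp (of_real (- \<tau>) \<cdot>\<^sub>m spectral_mat U (\<lambda>k. of_real (h k)))
      = spectral_mat U (\<lambda>k. of_real (exp (- \<tau> * h k)))"
    unfolding spectral_mat_smult mat_exp_spectral_mat of_real_mult[symmetric] exp_of_real ..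
  moreover have "mat_trace (spectral_mat U (\<lambda>k. of_real (exp (- \<tau> * h k)))) = of_real Z"
    unfolding mat_trace_spectral_mat Z_def by simp
  ultimately have rho: "gibbs_state (spectral_mat U (\<lambda>k. of_real (h k))) \<tau>
      = spectral_mat U (\<lambda>k. of_real (p k))"
    unfolding gibbs_state_def Let_def by (simp add: spectral_mat_smult p_def)
  have "von_neumann_entropy (spectral_mat U (\<lambda>k. of_real (p k))) = - (\<Sum>k<n. p k * ln (p k))"
    unfolding von_neumann_entropy_def mat_log_def hermitian_fun_spectral_mat spectral_mat_mult
      mat_trace_spectral_mat by simp
  also have "\<dots> = (\<Sum>k<n. \<tau> * (h k * exp (- \<tau> * h k)) / Z + exp (- \<tau> * h k) * (ln Z / Z))"
    unfolding sum_negf[symmetric] using Z by (intro sum.cong) (auto simp: p_def ln_div field_simps)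
  also have "\<dots> = \<tau> * (\<Sum>k<n. h k * exp (- \<tau> * h k)) / Z + Z * (ln Z / Z)"
    unfolding sum.distrib sum_distrib_right[symmetric] sum_distrib_left sum_divide_distrib Z_def ..
  finally show ?thesis
    using rho Z by simp
qed

end

section \<open>The spectrum of the cycle\<close>

lemma sum_roots_of_unity:
  fixes t :: int
  assumes "n > 0"
  shows "(\<Sum>k<n. cis (2 * pi * t * real k / n)) = (if int n dvd t then of_nat n else 0)"
proof -
  define z where "z = cis (2 * pi * t / n)"
  have pow: "cis (2 * pi * t * real k / n) = z ^ k" for k :: nat
    by (simp add: z_def Complex.DeMoivre mult.commute)
  have one: "z = 1 \<longleftrightarrow> int n dvd t"
  proof
    assume "z = 1"
    then have "cos (2 * pi * t / n) = 1"
      unfolding z_def by (metis cis.simps(1) one_complex.simps(1))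
    then obtain m :: int where "2 * pi * t / n = m * 2 * pi"
      unfolding cos_one_2pi_int by auto
    then have "real_of_int t = real_of_int (m * int n)"
      using \<open>n > 0\<close> by (simp add: field_simps)
    then show "int n dvd t" by (metis dvd_triv_right of_int_eq_iff)
  next
    assume "int n dvd t"
    then obtain m where "t = int n * m" ..
    then have "2 * pi * t / n = 2 * pi * m"
      using \<open>n > 0\<close> by simp
    then show "z = 1" unfolding z_def by (simp add: cis_multiple_2pi)
  qed
  have "z ^ n = cis (2 * pi * t)"
    unfolding pow[symmetric] using \<open>n > 0\<close> by simp
  then have "z ^ n = 1" by (simp add: cis_multiple_2pi)
  then show ?thesis
    unfolding pow using one by (cases "z = 1") (simp_all add: geometric_sum)
qed

text \<open>The columns are the characters of \<open>\<int>/n\<int>\<close>, normalised in \<open>\<ell>\<^sup>2\<close>; they diagonalise every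
  circulant matrix.\<close>

definition fourier_mat :: "nat \<Rightarrow> complex mat" where
  "fourier_mat n = Matrix.mat n n (\<lambda>(j, k). cis (2 * pi * j * real k / n) / of_real (sqrt n))"

lemma fourier_mat_carrier [simp]: "fourier_mat n \<in> carrier_mat n n"
  by (simp add: fourier_mat_def)

lemma fourier_mat_dim [simp]: "dim_row (fourier_mat n) = n" "dim_col (fourier_mat n) = n"
  by (simp_all add: fourier_mat_def)

lemma fourier_mat_mult_cnj:
  assumes "i < n" "j < n" "k < n"
  shows "fourier_mat n $$ (i, k) * c * cnj (fourier_mat n $$ (j, k))
    = c * cis (2 * pi * of_int (int i - int j) * real k / n) / n"
proof -
  have "cis (2 * pi * i * real k / n) * cnj (cis (2 * pi * j * real k / n))
      = cis (2 * pi * of_int (int i - int j) * real k / n)"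
    by (simp add: cis_cnj cis_mult algebra_simps diff_divide_distrib)
  moreover have "complex_of_real (sqrt n) * complex_of_real (sqrt n) = of_nat n"
    by (simp flip: of_real_mult)
  ultimately show ?thesis
    using assms by (simp add: fourier_mat_def field_simps)
qed

lemma int_dvd_diff_less:
  assumes "i < n" "j < n"
  shows "int n dvd int i - int j \<longleftrightarrow> i = j"
proof
  assume "int n dvd int i - int j"
  then have "int i mod int n = int j mod int n" by (simp add: mod_eq_dvd_iff)
  with assms show "i = j" by simp
qed auto

lemma spectral_mat_fourier_index:
  assumes "i < n" "j < n"
  shows "spectral_mat (fourier_mat n) d $$ (i, j)
    = (\<Sum>k<n. d k * cis (2 * pi * of_int (int i - int j) * real k / n)) / n"
  using assms by (simp add: spectral_mat_index[OF fourier_mat_carrier] fourier_mat_mult_cnj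
      sum_divide_distrib del: of_int_diff)

lemma unitary_fourier_mat: "unitary_mat (fourier_mat n)"
proof -
  note carr = fourier_mat_carrier[of n] mat_adjoint_carrier[OF fourier_mat_carrier[of n]]
  have "fourier_mat n * mat_adjoint (fourier_mat n) = spectral_mat (fourier_mat n) (\<lambda>_. 1)"
    by (simp add: spectral_mat_def right_mult_one_mat[of _ n n])
  also have "\<dots> = 1\<^sub>m n"
  proof (rule eq_matI)
    fix i j assume ij: "i < dim_row (1\<^sub>m n :: complex mat)" "j < dim_col (1\<^sub>m n :: complex mat)"
    then have "n > 0" by auto
    with ij show "spectral_mat (fourier_mat n) (\<lambda>_. 1) $$ (i, j) = 1\<^sub>m n $$ (i, j)"
      by (simp add: spectral_mat_fourier_index sum_roots_of_unity[of n] int_dvd_diff_less del: of_int_diff)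
  qed simp_all
  finally have 1: "fourier_mat n * mat_adjoint (fourier_mat n) = 1\<^sub>m n" .
  then have "mat_adjoint (fourier_mat n) * fourier_mat n = 1\<^sub>m n"
    using mat_mult_left_right_inverse carr by blast
  with 1 show ?thesis by (simp add: unitary_mat_def)
qed

lemma mem_cycle_edges_iff:
  assumes "i < n" "j < n"
  shows "{i, j} \<in> cycle_edges n \<longleftrightarrow> j = Suc i mod n \<or> i = Suc j mod n"
  using assms unfolding cycle_edges_def by (auto simp: doubleton_eq_iff)

lemma int_dvd_Suc_mod:
  assumes "i < n" "j < n"
  shows "int n dvd int i - int j + 1 \<longleftrightarrow> j = Suc i mod n"
proof -
  have "int n dvd int i - int j + 1 \<longleftrightarrow> int (Suc i) mod int n = int j mod int n"
    by (simp add: mod_eq_dvd_iff algebra_simps)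
  also have "\<dots> \<longleftrightarrow> Suc i mod n = j"
    using assms by (simp flip: of_nat_mod del: of_nat_Suc)
  finally show ?thesis by auto
qed

text \<open>By \<open>2 cos x = cis x + cis (- x)\<close> and orthogonality of characters, the entry at \<open>(i, j)\<close> of
  the right-hand side is \<open>[j = i + 1] + [j = i - 1]\<close> modulo \<open>n\<close>. At most one of the two brackets is
  nonzero because \<open>n \<ge> 3\<close>; for \<open>n = 2\<close> the single edge would be counted twice.\<close>

lemma adjacency_cycle_spectral:
  assumes "n \<ge> 3"
  shows "adjacency_mat n (cycle_edges n)
    = spectral_mat (fourier_mat n) (\<lambda>k. of_real (2 * cos (2 * pi * real k / n)))"
proof (rule eq_matI)
  let ?e = "\<lambda>k. complex_of_real (2 * cos (2 * pi * real k / real n))"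
  show "dim_row (adjacency_mat n (cycle_edges n)) = dim_row (spectral_mat (fourier_mat n) ?e)"
    "dim_col (adjacency_mat n (cycle_edges n)) = dim_col (spectral_mat (fourier_mat n) ?e)"
    by (simp_all add: adjacency_mat_def)
  fix i j assume "i < dim_row (spectral_mat (fourier_mat n) ?e)"
    "j < dim_col (spectral_mat (fourier_mat n) ?e)"
  then have ij: "i < n" "j < n" by simp_all
  have "of_real (2 * cos (2 * pi * real k / n)) * cis (2 * pi * of_int (int i - int j) * real k / n)
      = cis (2 * pi * of_int (int i - int j + 1) * real k / n)
        + cis (2 * pi * of_int (int i - int j - 1) * real k / n)" for k
  proof -
    have "complex_of_real (2 * cos x) = cis x + cis (- x)" for x
      by (simp add: complex_eq_iff)
    then show ?thesis
      by (simp add: distrib_right cis_mult algebra_simps add_divide_distrib diff_divide_distrib)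
  qed
  then have "spectral_mat (fourier_mat n) ?e $$ (i, j)
      = ((if int n dvd int i - int j + 1 then of_nat n else 0)
        + (if int n dvd int i - int j - 1 then of_nat n else 0)) / n"
    using ij assms by (simp add: spectral_mat_fourier_index sum.distrib sum_roots_of_unity[of n]
        del: of_int_diff of_int_add of_real_mult)
  also have "int n dvd int i - int j - 1 \<longleftrightarrow> int n dvd int j - int i + 1"
    using dvd_minus_iff[of "int n" "int i - int j - 1"] by (simp add: algebra_simps)
  finally have "spectral_mat (fourier_mat n) ?e $$ (i, j)
      = ((if j = Suc i mod n then of_nat n else 0) + (if i = Suc j mod n then of_nat n else 0)) / n"
    by (simp add: int_dvd_Suc_mod ij)
  moreover have "\<not> (j = Suc i mod n \<and> i = Suc j mod n)"
    using assms ij by (auto simp: mod_Suc split: if_splits)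
  ultimately show "adjacency_mat n (cycle_edges n) $$ (i, j) = spectral_mat (fourier_mat n) ?e $$ (i, j)"
    using ij assms by (auto simp: adjacency_mat_def mem_cycle_edges_iff)
qed

text \<open>The edges at \<open>i\<close> are those leading to its successor and from its predecessor \<open>p\<close>; they
  differ because \<open>p\<close> is not also the successor of \<open>i\<close> when \<open>n \<ge> 3\<close>.\<close>

lemma card_cycle_edges_at:
  assumes "n \<ge> 3" "i < n"
  shows "card {e \<in> cycle_edges n. i \<in> e} = 2"
proof -
  define p where "p = (if i = 0 then n - 1 else i - 1)"
  have p: "p < n" "Suc p mod n = i" "p \<noteq> i" "p \<noteq> Suc i mod n" "i \<noteq> Suc i mod n"
    using assms by (auto simp: p_def mod_Suc split: if_splits)
  have "k = p" if "k < n" "Suc k mod n = i" for k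
    using that p assms by (auto simp: mod_Suc split: if_splits)
  then have "{e \<in> cycle_edges n. i \<in> e} = (\<lambda>k. {k, Suc k mod n}) ` {i, p}"
    using p(1,2) \<open>i < n\<close> unfolding cycle_edges_def by blast
  then have "{e \<in> cycle_edges n. i \<in> e} = {{i, Suc i mod n}, {p, i}}"
    using p(2) by simp
  then show ?thesis using p by (auto simp: doubleton_eq_iff)
qed

lemma laplacian_cycle_spectral:
  assumes "n \<ge> 3"
  shows "laplacian_mat n (cycle_edges n)
    = spectral_mat (fourier_mat n) (\<lambda>k. of_real (2 - 2 * cos (2 * pi * real k / n)))"
proof -
  note F = fourier_mat_carrier[of n] and u = unitary_fourier_mat[of n]
  have "degree_mat n (cycle_edges n) = 2 \<cdot>\<^sub>m 1\<^sub>m n"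
    using card_cycle_edges_at[OF assms] by (intro eq_matI) (auto simp: degree_mat_def mat_diag_def)
  also have "\<dots> = spectral_mat (fourier_mat n) (\<lambda>_. 2)"
    using spectral_mat_smult[OF F u, of 2 "\<lambda>_. 1"] by (simp add: spectral_mat_one[OF F u])
  finally have deg: "degree_mat n (cycle_edges n) = spectral_mat (fourier_mat n) (\<lambda>_. 2)" .
  show ?thesis
    unfolding laplacian_mat_def deg adjacency_cycle_spectral[OF assms]
    by (intro eq_matI) (simp_all add: spectral_mat_fourier_index algebra_simps
        sum_subtractf diff_divide_distrib del: of_int_diff)
qed

section \<open>Averages over the spectrum of the cycle\<close>

text \<open>The mean of \<open>f\<close> over the eigenvalues of \<open>A(C\<^sub>n)\<close>, with multiplicity; at \<open>n = 0\<close> it is \<open>0\<close>.\<close>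

definition cycle_mean :: "(real \<Rightarrow> real) \<Rightarrow> nat \<Rightarrow> real" where
  "cycle_mean f n = (\<Sum>k<n. f (2 * cos (2 * pi * real k / n))) / n"

text \<open>Expanding \<open>(cis x + cis (- x)) ^ m\<close> gives the frequencies \<open>2 j - m\<close> with \<open>j \<le> m\<close>, and the
  mean keeps those divisible by \<open>n\<close>. Since \<open>\<bar>2 j - m\<bar> \<le> m < n\<close>, only the frequency \<open>0\<close> remains.\<close>

lemma cycle_mean_power:
  assumes "m < n"
  shows "cycle_mean (\<lambda>x. x ^ m) n = (if even m then real (m choose (m div 2)) else 0)"
proof -
  have n: "n > 0" using assms by simp
  have "of_real ((2 * cos (2 * pi * real k / n)) ^ m)
      = (\<Sum>j\<le>m. of_nat (m choose j) * cis (2 * pi * of_int (2 * int j - int m) * real k / n))" for k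
  proof -
    let ?x = "2 * pi * real k / n"
    have "complex_of_real (2 * cos ?x) = cis ?x + cis (- ?x)"
      by (simp add: complex_eq_iff)
    then have "complex_of_real ((2 * cos ?x) ^ m) = (cis ?x + cis (- ?x)) ^ m"
      by (simp only: of_real_power)
    also have "\<dots> = (\<Sum>j\<le>m. of_nat (m choose j) * cis ?x ^ j * cis (- ?x) ^ (m - j))"
      by (rule binomial_ring)
    also have "\<dots> = (\<Sum>j\<le>m. of_nat (m choose j) * cis (2 * pi * of_int (2 * int j - int m) * real k / n))"
    proof (intro sum.cong refl)
      fix j assume "j \<in> {..m}"
      then have "cis ?x ^ j * cis (- ?x) ^ (m - j) = cis (2 * pi * of_int (2 * int j - int m) * real k / n)"
        unfolding Complex.DeMoivre cis_mult
        by (intro arg_cong[where f = cis]) (simp add: of_nat_diff algebra_simps diff_divide_distrib add_divide_distrib)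
      then show "of_nat (m choose j) * cis ?x ^ j * cis (- ?x) ^ (m - j)
          = of_nat (m choose j) * cis (2 * pi * of_int (2 * int j - int m) * real k / n)"
        by (simp add: mult.assoc)
    qed
    finally show ?thesis .
  qed
  then have "complex_of_real (cycle_mean (\<lambda>x. x ^ m) n)
      = (\<Sum>k<n. \<Sum>j\<le>m. of_nat (m choose j) * cis (2 * pi * of_int (2 * int j - int m) * real k / n)) / n"
    unfolding cycle_mean_def by (simp del: of_real_power of_real_mult of_int_diff)
  also have "\<dots> = (\<Sum>j\<le>m. of_nat (m choose j) * (if int n dvd 2 * int j - int m then of_nat n else 0 :: complex)) / of_nat n"
    by (subst sum.swap) (simp only: sum_distrib_left[symmetric] sum_roots_of_unity[OF n])
  also have "\<dots> = (\<Sum>j\<le>m. if 2 * j = m then of_nat (m choose j) else 0)"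
    unfolding sum_divide_distrib
  proof (intro sum.cong refl)
    fix j assume "j \<in> {..m}"
    then have "\<bar>2 * int j - int m\<bar> < int n" using assms by auto
    then have "int n dvd 2 * int j - int m \<longleftrightarrow> 2 * int j - int m = 0"
      using dvd_imp_le_int[of "2 * int j - int m" "int n"] by force
    then have "int n dvd 2 * int j - int m \<longleftrightarrow> 2 * j = m" by linarith
    then show "of_nat (m choose j) * (if int n dvd 2 * int j - int m then of_nat n else 0) / of_nat n
        = (if 2 * j = m then of_nat (m choose j) else 0 :: complex)"
      using n by simp
  qed
  also have "\<dots> = (\<Sum>j\<le>m. if even m \<and> j = m div 2 then of_nat (m choose (m div 2)) else 0)"
    by (intro sum.cong) auto
  also have "\<dots> = of_real (if even m then real (m choose (m div 2)) else 0)"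
    by (cases "even m") simp_all
  finally show ?thesis unfolding of_real_eq_iff .
qed

lemma abs_cycle_mean_power_le: "\<bar>cycle_mean (\<lambda>x. x ^ m) n\<bar> \<le> 2 ^ m"
proof (cases "n = 0")
  case False
  have "\<bar>\<Sum>k<n. (2 * cos (2 * pi * real k / n)) ^ m\<bar> \<le> (\<Sum>k<n. \<bar>(2 * cos (2 * pi * real k / n)) ^ m\<bar>)"
    by (rule sum_abs)
  also have "\<dots> \<le> (\<Sum>k<n. 2 ^ m)"
    by (intro sum_mono) (auto simp: power_abs abs_mult intro!: mult_le_one power_le_one)
  finally show ?thesis
    using False by (simp add: cycle_mean_def divide_simps mult.commute)
qed (simp add: cycle_mean_def)

text \<open>Tannery's theorem: for each fixed \<open>m\<close> the moment is eventually constant in \<open>n\<close>, and it is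
  dominated by \<open>2 ^ m\<close>.\<close>

lemma cycle_mean_powser_tendsto:
  fixes a :: "nat \<Rightarrow> real"
  assumes f: "\<And>x. (\<lambda>m. a m * x ^ m) sums f x"
    and summable: "summable (\<lambda>m. \<bar>a m\<bar> * 2 ^ m)"
  shows "cycle_mean f \<longlonglongrightarrow> (\<Sum>j. a (2 * j) * real ((2 * j) choose j))"
    and "summable (\<lambda>j. a (2 * j) * real ((2 * j) choose j))"
proof -
  define b where "b m = a m * (if even m then real (m choose (m div 2)) else 0)" for m
  have mean: "cycle_mean f n = (\<Sum>m. a m * cycle_mean (\<lambda>x. x ^ m) n)" for n
  proof -
    have "(\<lambda>m. (\<Sum>k<n. a m * (2 * cos (2 * pi * real k / n)) ^ m) / n) sums cycle_mean f n"
      unfolding cycle_mean_def by (intro sums_divide sums_sum f)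
    then show ?thesis
      by (simp add: sums_iff cycle_mean_def sum_distrib_left)
  qed
  have lim: "(\<lambda>n. a m * cycle_mean (\<lambda>x. x ^ m) n) \<longlonglongrightarrow> b m" for m
    by (rule tendsto_eventually, rule eventually_mono[OF eventually_gt_at_top[of m]])
       (simp add: b_def cycle_mean_power)
  have bound: "norm (a m * cycle_mean (\<lambda>x. x ^ m) n) \<le> \<bar>a m\<bar> * 2 ^ m" for m n
    by (simp add: abs_mult mult_left_mono abs_cycle_mean_power_le)
  have "(\<lambda>n. \<Sum>m. a m * cycle_mean (\<lambda>x. x ^ m) n) \<longlonglongrightarrow> suminf b \<and> summable (\<lambda>m. norm (b m))"
    using tannerys_theorem[where a = "\<lambda>m n. a m * cycle_mean (\<lambda>x. x ^ m) n", OF lim always_eventually summable]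
      bound by simp
  then have 1: "cycle_mean f \<longlonglongrightarrow> suminf b" and 2: "summable b"
    by (auto simp: mean[abs_def] summable_norm_cancel)
  \<comment> \<open>Only the even moments contribute to the limit.\<close>
  have "(\<lambda>j. b (2 * j)) sums suminf b"
  proof (subst sums_mono_reindex[where g = "\<lambda>j. 2 * j"])
    show "strict_mono (\<lambda>j::nat. 2 * j)" by (auto simp: strict_mono_def)
    show "b m = 0" if "m \<notin> range (\<lambda>j. 2 * j)" for m
      using that by (auto simp: b_def elim!: evenE)
    show "b sums suminf b" using 2 by (rule summable_sums)
  qed
  then have "(\<lambda>j. a (2 * j) * real ((2 * j) choose j)) sums suminf b"
    by (simp add: b_def)
  with 1 show "cycle_mean f \<longlonglongrightarrow> (\<Sum>j. a (2 * j) * real ((2 * j) choose j))"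
    "summable (\<lambda>j. a (2 * j) * real ((2 * j) choose j))"
    by (auto simp: sums_iff)
qed

lemma real_central_binomial: "real ((2 * j) choose j) = fact (2 * j) / (fact j * fact j)"
  by (simp add: binomial_fact)

lemma bessel_I_of_nat:
  assumes "x > 0"
  shows "bessel_I (real k) x = (\<Sum>m. (x / 2) ^ (2 * m + k) / (fact m * fact (m + k)))"
proof -
  have "rGamma (real m + real k + 1) = 1 / fact (m + k)" for m
    using Gamma_fact[of "m + k", where 'a = real]
    by (simp add: rGamma_inverse_Gamma algebra_simps inverse_eq_divide)
  moreover have "(x / 2) powr (2 * real m + real k) = (x / 2) ^ (2 * m + k)" for m
    using assms powr_realpow[of "x / 2" "2 * m + k"] by simp
  ultimately show ?thesis
    unfolding bessel_I_def by (simp add: mult.commute)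
qed

lemma cycle_mean_exp_tendsto:
  assumes "\<tau> > 0"
  shows "cycle_mean (\<lambda>x. exp (\<tau> * x)) \<longlonglongrightarrow> bessel_I 0 (2 * \<tau>)"
proof -
  have exp: "(\<lambda>m. \<tau> ^ m / fact m * x ^ m) sums exp (\<tau> * x)" for x
    using exp_converges[of "\<tau> * x"] by (simp add: power_mult_distrib divide_inverse algebra_simps)
  have "cycle_mean (\<lambda>x. exp (\<tau> * x))
      \<longlonglongrightarrow> (\<Sum>j. \<tau> ^ (2 * j) / fact (2 * j) * real ((2 * j) choose j))"
    using exp assms sums_summable[OF exp[of 2]] by (intro cycle_mean_powser_tendsto) simp_all
  also have "(\<Sum>j. \<tau> ^ (2 * j) / fact (2 * j) * real ((2 * j) choose j)) = bessel_I 0 (2 * \<tau>)"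
    using bessel_I_of_nat[of "2 * \<tau>" 0] assms by (simp add: real_central_binomial)
  finally show ?thesis .
qed

text \<open>The factor \<open>x\<close> shifts the exponential series by one, so the even powers now carry the
  coefficients \<open>\<tau> ^ (2 j - 1) / (2 j - 1)!\<close>. Their products with the central binomial
  coefficients are \<open>2 \<tau> ^ (2 j - 1) / ((j - 1)! j!)\<close>, twice the terms of \<open>I\<^sub>1 (2 \<tau>)\<close>.\<close>

lemma cycle_mean_times_exp_tendsto:
  assumes "\<tau> > 0"
  shows "cycle_mean (\<lambda>x. x * exp (\<tau> * x)) \<longlonglongrightarrow> 2 * bessel_I 1 (2 * \<tau>)"
proof -
  define a where "a m = (if m = 0 then 0 else \<tau> ^ (m - 1) / fact (m - 1))" for m :: nat
  have ser: "(\<lambda>m. a m * x ^ m) sums (x * exp (\<tau> * x))" for x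
  proof -
    have "(\<lambda>m. x * (\<tau> ^ m / fact m * x ^ m)) sums (x * exp (\<tau> * x))"
      using exp_converges[of "\<tau> * x"] by (intro sums_mult) (simp add: power_mult_distrib divide_inverse algebra_simps)
    then have "(\<lambda>m. a (Suc m) * x ^ Suc m) sums (x * exp (\<tau> * x))"
      by (simp add: a_def algebra_simps)
    then show ?thesis
      by (subst (asm) sums_Suc_iff) (simp add: a_def)
  qed
  have nonneg: "\<bar>a m\<bar> = a m" for m using assms by (simp add: a_def)
  have lim: "cycle_mean (\<lambda>x. x * exp (\<tau> * x)) \<longlonglongrightarrow> (\<Sum>j. a (2 * j) * real ((2 * j) choose j))"
    and summ: "summable (\<lambda>j. a (2 * j) * real ((2 * j) choose j))"
    using ser sums_summable[OF ser[of 2]] cycle_mean_powser_tendsto[OF ser] by (simp_all add: nonneg)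
  let ?b = "\<lambda>m. \<tau> ^ (2 * m + 1) / (fact m * fact (m + 1))"
  have coeff: "a (2 * Suc m) * real ((2 * Suc m) choose Suc m) = 2 * ?b m" for m
  proof -
    have "fact (2 * Suc m) = 2 * (1 + real m) * fact (2 * m + 1)"
      using fact_Suc[of "2 * m + 1", where 'a = real] by (simp add: algebra_simps)
    then show ?thesis
      unfolding real_central_binomial a_def by (simp add: divide_simps)
  qed
  have bessel: "bessel_I 1 (2 * \<tau>) = (\<Sum>m. ?b m)"
    using bessel_I_of_nat[of "2 * \<tau>" 1] assms by simp
  have "summable (\<lambda>m. 2 * ?b m)"
    using summ unfolding summable_Suc_iff[of "\<lambda>j. a (2 * j) * real ((2 * j) choose j)", symmetric] coeff .
  then have "summable ?b" by (subst (asm) summable_cmult_iff) simp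
  then have "(\<lambda>m. a (2 * Suc m) * real ((2 * Suc m) choose Suc m)) sums (2 * bessel_I 1 (2 * \<tau>))"
    unfolding coeff bessel by (intro sums_mult summable_sums)
  then have "(\<lambda>j. a (2 * j) * real ((2 * j) choose j)) sums (2 * bessel_I 1 (2 * \<tau>))"
    by (subst (asm) sums_Suc_iff) (simp add: a_def)
  with lim show ?thesis by (simp add: sums_iff)
qed

text \<open>Positivity passes to the limit from the uniform bound \<open>exp (- 2 \<tau>)\<close> on the means. It is
  what allows the quotient and the logarithm of the means to converge.\<close>

lemma bessel_I_0_pos:
  assumes "\<tau> > 0"
  shows "bessel_I 0 (2 * \<tau>) > 0"
proof -
  have "cycle_mean (\<lambda>x. exp (\<tau> * x)) n \<ge> exp (- 2 * \<tau>)" if "n > 0" for n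
  proof -
    have "(\<Sum>k<n. exp (- 2 * \<tau>)) \<le> (\<Sum>k<n. exp (\<tau> * (2 * cos (2 * pi * real k / n))))"
    proof (intro sum_mono)
      fix k
      have "\<tau> * (- 1) \<le> \<tau> * cos (2 * pi * real k / n)"
        using assms by (intro mult_left_mono) auto
      then show "exp (- 2 * \<tau>) \<le> exp (\<tau> * (2 * cos (2 * pi * real k / n)))" by simp
    qed
    then show ?thesis
      using that by (simp add: cycle_mean_def field_simps)
  qed
  then have "exp (- 2 * \<tau>) \<le> bessel_I 0 (2 * \<tau>)"
    by (intro tendsto_lowerbound[OF cycle_mean_exp_tendsto[OF assms]])
       (auto intro: eventually_mono[OF eventually_gt_at_top[of 0]])
  then show ?thesis
    by (meson exp_gt_zero less_le_trans)
qed

section \<open>The entropy of the cycle\<close>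

lemma neg_adjacency_cycle_spectral:
  assumes "n \<ge> 3"
  shows "- adjacency_mat n (cycle_edges n)
    = spectral_mat (fourier_mat n) (\<lambda>k. of_real (- (2 * cos (2 * pi * real k / n))))"
proof -
  have "- adjacency_mat n (cycle_edges n) = (-1) \<cdot>\<^sub>m adjacency_mat n (cycle_edges n)"
    by (intro eq_matI) auto
  then show ?thesis
    unfolding adjacency_cycle_spectral[OF assms]
      spectral_mat_smult[OF fourier_mat_carrier unitary_fourier_mat] by simp
qed

lemma adjacency_entropy_cycle:
  assumes "n \<ge> 3"
  shows "adjacency_entropy n (cycle_edges n) \<tau>
    = ln n - \<tau> * (cycle_mean (\<lambda>x. x * exp (\<tau> * x)) n / cycle_mean (\<lambda>x. exp (\<tau> * x)) n)
      + ln (cycle_mean (\<lambda>x. exp (\<tau> * x)) n)"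
proof -
  define Z where "Z = (\<Sum>k<n. exp (\<tau> * (2 * cos (2 * pi * real k / n))))"
  have n: "n > 0" using assms by simp
  have Z: "Z > 0" unfolding Z_def using n by (intro sum_pos) auto
  have "adjacency_entropy n (cycle_edges n) \<tau>
      = - \<tau> * (\<Sum>k<n. 2 * cos (2 * pi * real k / n) * exp (\<tau> * (2 * cos (2 * pi * real k / n)))) / Z + ln Z"
    unfolding adjacency_entropy_def Z_def neg_adjacency_cycle_spectral[OF assms]
    by (simp add: entropy_gibbs_state[OF fourier_mat_carrier unitary_fourier_mat n] sum_negf
        del: of_real_mult of_real_minus)
  also have "ln Z = ln n + ln (Z / n)"
    using Z n by (simp add: ln_div)
  finally show ?thesis
    using n by (simp add: cycle_mean_def Z_def)
qed

text \<open>Raising all energies by \<open>2\<close> multiplies the partition function by \<open>exp (- 2 \<tau>)\<close>, which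
  lowers its logarithm by \<open>2 \<tau>\<close> and so compensates the increase of \<open>\<tau>\<close> times the mean energy.\<close>

lemma adjacency_entropy_cycle_eq_laplacian:
  assumes "n \<ge> 3"
  shows "adjacency_entropy n (cycle_edges n) \<tau> = laplacian_entropy n (cycle_edges n) \<tau>"
proof -
  define h where "h k = - (2 * cos (2 * pi * real k / n))" for k
  define Z where "Z = (\<Sum>k<n. exp (- \<tau> * h k))"
  have n: "n > 0" using assms by simp
  have Z: "Z > 0" unfolding Z_def using n by (intro sum_pos) auto
  note entropy = entropy_gibbs_state[OF fourier_mat_carrier unitary_fourier_mat n]
  have A: "adjacency_entropy n (cycle_edges n) \<tau> = \<tau> * (\<Sum>k<n. h k * exp (- \<tau> * h k)) / Z + ln Z"
    unfolding adjacency_entropy_def Z_def h_def neg_adjacency_cycle_spectral[OF assms]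
    by (simp only: entropy)
  have "laplacian_mat n (cycle_edges n) = spectral_mat (fourier_mat n) (\<lambda>k. of_real (2 + h k))"
    unfolding laplacian_cycle_spectral[OF assms] h_def by simp
  then have L: "laplacian_entropy n (cycle_edges n) \<tau>
      = \<tau> * (\<Sum>k<n. (2 + h k) * exp (- \<tau> * (2 + h k))) / (\<Sum>k<n. exp (- \<tau> * (2 + h k)))
        + ln (\<Sum>k<n. exp (- \<tau> * (2 + h k)))"
    unfolding laplacian_entropy_def by (simp only: entropy)
  define c where "c = exp (- 2 * \<tau>)"
  have c: "c > 0" "ln c = - 2 * \<tau>" by (simp_all add: c_def)
  have shift: "exp (- \<tau> * (2 + h k)) = c * exp (- \<tau> * h k)" for k
    by (simp add: c_def algebra_simps flip: exp_add)
  have Zc: "(\<Sum>k<n. exp (- \<tau> * (2 + h k))) = c * Z"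
    unfolding shift Z_def sum_distrib_left ..
  have "(\<Sum>k<n. (2 + h k) * exp (- \<tau> * (2 + h k))) = c * (2 * Z + (\<Sum>k<n. h k * exp (- \<tau> * h k)))"
    unfolding shift Z_def by (simp add: sum_distrib_left sum.distrib algebra_simps)
  then show ?thesis
    unfolding L Zc A using c Z by (simp add: ln_mult field_simps)
qed

theorem mainTheorem8:
  fixes \<tau> :: real
  assumes "\<tau> > 0"
  shows "(\<forall>n\<ge>3. adjacency_entropy n (cycle_edges n) \<tau> = laplacian_entropy n (cycle_edges n) \<tau>) \<and>
    (\<lambda>n. laplacian_entropy n (cycle_edges n) \<tau>
        - (ln (real n) - 2 * \<tau> * (bessel_I 1 (2 * \<tau>) / bessel_I 0 (2 * \<tau>))
            + ln (bessel_I 0 (2 * \<tau>)))) \<in> o(\<lambda>_. 1)"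
proof
  show "\<forall>n\<ge>3. adjacency_entropy n (cycle_edges n) \<tau> = laplacian_entropy n (cycle_edges n) \<tau>"
    using adjacency_entropy_cycle_eq_laplacian by blast
  let ?E = "cycle_mean (\<lambda>x. exp (\<tau> * x))" and ?C = "cycle_mean (\<lambda>x. x * exp (\<tau> * x))"
  let ?L = "\<lambda>n. laplacian_entropy n (cycle_edges n) \<tau>"
  let ?I0 = "bessel_I 0 (2 * \<tau>)" and ?I1 = "bessel_I 1 (2 * \<tau>)"
  have "(\<lambda>n. - \<tau> * (?C n / ?E n) + ln (?E n) - (- 2 * \<tau> * (?I1 / ?I0) + ln ?I0))
      \<longlonglongrightarrow> - \<tau> * (2 * ?I1 / ?I0) + ln ?I0 - (- 2 * \<tau> * (?I1 / ?I0) + ln ?I0)"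
    using bessel_I_0_pos[OF assms]
    by (intro tendsto_intros cycle_mean_exp_tendsto cycle_mean_times_exp_tendsto assms) auto
  then have "(\<lambda>n. - \<tau> * (?C n / ?E n) + ln (?E n) - (- 2 * \<tau> * (?I1 / ?I0) + ln ?I0)) \<longlonglongrightarrow> 0"
    by simp
  moreover have "\<forall>\<^sub>F n in sequentially.
      - \<tau> * (?C n / ?E n) + ln (?E n) - (- 2 * \<tau> * (?I1 / ?I0) + ln ?I0)
      = ?L n - (ln (real n) - 2 * \<tau> * (?I1 / ?I0) + ln ?I0)"
    using eventually_ge_at_top[of 3]
    by eventually_elim
       (simp add: adjacency_entropy_cycle flip: adjacency_entropy_cycle_eq_laplacian)
  ultimately show "(\<lambda>n. ?L n - (ln (real n) - 2 * \<tau> * (?I1 / ?I0) + ln ?I0)) \<in> o(\<lambda>_. 1)"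
    by (intro smalloI_tendsto) (simp_all only: div_by_1 Lim_transform_eventually, simp)
qed

end
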